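(* For all integers $m,n\ge 3$, \[\textup{aw}(C_m\square C_n,3)=\begin{cases}4 & \text{if $m$ and $n$ are even and $\textup{diam}(C_m\square C_n)$ is odd,}\\ 3 & \text{otherwise.}\end{cases}\]
   Context: All graphs are finite, simple and undirected; $\textup{d}(u,v)$ denotes shortest-path distance and $\textup{diam}$ the diameter. $C_n$ is the cycle on $n$ vertices. The Cartesian product $G\square H$ has vertex set $V(G)\times V(H)$, with $(x,y)$ adjacent to $(x',y')$ iff either $x=x'$ and $yy'\in E(H)$, or $y=y'$ and $xx'\in E(G)$. A 3-term arithmetic progression (3-AP) in a graph is a set of vertices $\{v_1,v_2,v_3\}$ (listed in some order) with $\textup{d}(v_1,v_2)=\textup{d}(v_2,v_3)$. An exact $r$-coloring of a graph $G$ is a surjective map $c:V(G)\to\{1,\dots,r\}$; a set of vertices is rainbow under $c$ if its vertices receive pairwise distinct colors. The anti-van der Waerden number $\textup{aw}(G,3)$ is the least positive integer $r$ such that every exact $r$-coloring of $G$ contains a rainbow 3-AP; if no coloring of $V(G)$ yields a rainbow 3-AP, then $\textup{aw}(G,3)=|V(G)|+1$. *)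

theory Defs
  imports "Graph_Theory.Graph_Theory"
begin

text \<open>
  A simple undirected graph is a \<open>pair_graph\<close>: finite, loop-free, with a symmetric arc relation,
  so an edge is a pair of opposite arcs.
\<close>

definition cycle_graph :: "nat \<Rightarrow> nat pair_pre_digraph" where
  "cycle_graph n =
    \<lparr> pverts = {..<n},
      parcs = {(i, j). i < n \<and> j < n \<and> (j = (i + 1) mod n \<or> i = (j + 1) mod n)} \<rparr>"

definition cartesian_product ::
    "'a pair_pre_digraph \<Rightarrow> 'b pair_pre_digraph \<Rightarrow> ('a \<times> 'b) pair_pre_digraph"
    (infixr "\<box>" 80) where
  "G \<box> H =
    \<lparr> pverts = pverts G \<times> pverts H,
      parcs = {((x, y), (x', y')).
                 x = x' \<and> x \<in> pverts G \<and> (y, y') \<in> parcs H \<or>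
                 y = y' \<and> y \<in> pverts H \<and> (x, x') \<in> parcs G} \<rparr>"

lemma pair_graph_cycle_graph:
  assumes "n \<ge> 3"
  shows "pair_graph (cycle_graph n)"
proof
  fix e assume e: "e \<in> parcs (cycle_graph n)"
  show "fst e \<in> pverts (cycle_graph n)" "snd e \<in> pverts (cycle_graph n)"
    using e by (auto simp: cycle_graph_def)
  have "Suc i mod n \<noteq> i" if "i < n" for i
    using that assms by (simp add: mod_Suc)
  then show "fst e \<noteq> snd e"
    using e by (auto simp: cycle_graph_def) metis+
next
  show "finite (pverts (cycle_graph n))"
    by (simp add: cycle_graph_def)
  show "finite (parcs (cycle_graph n))"
    by (rule finite_subset[of _ "{..<n} \<times> {..<n}"]) (auto simp: cycle_graph_def)
  show "symmetric (with_proj (cycle_graph n))"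
    by (auto simp: symmetric_def cycle_graph_def sym_def)
qed

lemma pair_graph_cartesian_product:
  assumes "pair_graph G" "pair_graph H"
  shows "pair_graph (G \<box> H)"
proof -
  interpret G: pair_graph G by fact
  interpret H: pair_graph H by fact
  note wf = G.wellformed' H.wellformed'
  show ?thesis
  proof
    fix e assume e: "e \<in> parcs (G \<box> H)"
    show "fst e \<in> pverts (G \<box> H)" "snd e \<in> pverts (G \<box> H)"
      using e wf by (auto simp: cartesian_product_def)
    show "fst e \<noteq> snd e"
      using e G.pair_no_loops H.pair_no_loops by (fastforce simp: cartesian_product_def)
  next
    show fin: "finite (pverts (G \<box> H))"
      using G.pair_finite_verts H.pair_finite_verts by (simp add: cartesian_product_def)
    show "finite (parcs (G \<box> H))"
      by (rule finite_subset[OF _ finite_cartesian_product[OF fin fin]])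
         (use wf in \<open>auto simp: cartesian_product_def\<close>)
    show "symmetric (with_proj (G \<box> H))"
      using G.pair_sym_arcs H.pair_sym_arcs
      by (auto simp: symmetric_def cartesian_product_def sym_def)
  qed
qed

text \<open>
  The library's shortest-path distance \<open>\<mu>\<close> with unit arc weights. It is only specified for
  well-formed digraphs, which the two lemmas above provide for the graphs of interest.
\<close>

definition gdist :: "'a pair_pre_digraph \<Rightarrow> 'a \<Rightarrow> 'a \<Rightarrow> ereal" where
  "gdist G u v = wf_digraph.\<mu> (with_proj G) (\<lambda>_. 1) u v"

definition diam :: "'a pair_pre_digraph \<Rightarrow> ereal" where
  "diam G = (SUP u \<in> pverts G. SUP v \<in> pverts G. gdist G u v)"

text \<open>
  The three terms must be distinct: otherwise any two vertices of different colors
  would form a rainbow progression (take \<open>v\<^sub>1 = v\<^sub>3\<close>).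
\<close>

definition three_AP :: "'a pair_pre_digraph \<Rightarrow> 'a set \<Rightarrow> bool" where
  "three_AP G S \<longleftrightarrow>
    (\<exists>v1 v2 v3. {v1, v2, v3} \<subseteq> pverts G \<and> distinct [v1, v2, v3] \<and>
       S = {v1, v2, v3} \<and> gdist G v1 v2 = gdist G v2 v3)"

definition exact_coloring :: "'a pair_pre_digraph \<Rightarrow> nat \<Rightarrow> ('a \<Rightarrow> nat) \<Rightarrow> bool" where
  "exact_coloring G r c \<longleftrightarrow> c ` pverts G = {1..r}"

definition rainbow :: "('a \<Rightarrow> nat) \<Rightarrow> 'a set \<Rightarrow> bool" where
  "rainbow c S \<longleftrightarrow> inj_on c S"

definition has_rainbow_three_AP :: "'a pair_pre_digraph \<Rightarrow> ('a \<Rightarrow> nat) \<Rightarrow> bool" where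
  "has_rainbow_three_AP G c \<longleftrightarrow> (\<exists>S. three_AP G S \<and> rainbow c S)"

text \<open>The parameter \<open>k = 3\<close> of the anti-van der Waerden number \<open>aw(G, k)\<close> is fixed.\<close>

definition aw3 :: "'a pair_pre_digraph \<Rightarrow> nat" where
  "aw3 G =
    (if \<exists>r c. exact_coloring G r c \<and> has_rainbow_three_AP G c
     then LEAST r. r > 0 \<and> (\<forall>c. exact_coloring G r c \<longrightarrow> has_rainbow_three_AP G c)
     else card (pverts G) + 1)"

end

theory Submission
  imports Defs
begin

text \<open>
  Colorings of the torus are treated as doubly periodic colorings of \<open>\<int> \<times> \<int>\<close> with the distance
  \<open>cyc_dist m (x - x') + cyc_dist n (y - y')\<close>, so that translations, reflections and the exchange of
  the axes are symmetries. Let a three-coloring have no rainbow progression.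

  A shortest horizontal segment containing all three colors would force, through the row next to it,
  a shorter one; hence rows and columns carry at most two colors. It follows that some two colors, say
  \<open>B\<close> and \<open>G\<close>, are nowhere adjacent. Take \<open>u\<close> of color \<open>B\<close> and \<open>v\<close> of color \<open>G\<close> at minimal distance
  \<open>k\<close>. A midpoint of \<open>u\<close> and \<open>v\<close> would have no admissible color, so \<open>k\<close> is odd and at least 3. A
  vertex at distance \<open>k\<close> from \<open>u\<close> does not have the third color, and if it is closer than \<open>k\<close> to \<open>v\<close>
  it must have the color of \<open>v\<close>; the same holds with \<open>u\<close> and \<open>v\<close> exchanged. Propagating colors in
  this way yields a \<open>B\<close>-\<open>G\<close> pair at distance less than \<open>k\<close>, unless \<open>m\<close> and \<open>n\<close> are even and \<open>u\<close>, \<open>v\<close>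
  are antipodal, in which case \<open>k\<close> is the diameter and every \<open>B\<close>-\<open>G\<close> pair is antipodal.

  With four colors, merge two of them in two different ways: one color class would then be antipodal
  to two others, but antipodes are unique. Conversely, if \<open>m\<close> and \<open>n\<close> are even, the distances from any
  vertex to a fixed antipodal pair add up to the diameter; when it is odd, giving the two antipodal
  points private colors and everything else a third color leaves no rainbow progression.
\<close>

subsection \<open>Distances in cycles\<close>

text \<open>The distance from 0 to the residue of \<open>x\<close> in the cycle of length
  \<open>m\<close>: the shorter way round. Taking any integer as argument lets differences of
  coordinates enter without reduction.\<close>

definition cyc_dist :: "int \<Rightarrow> int \<Rightarrow> int" where
  "cyc_dist m x = min (x mod m) ((- x) mod m)"

lemma cyc_dist_eq:
  assumes "\<bar>x\<bar> \<le> m"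
  shows "cyc_dist m x = min \<bar>x\<bar> (m - \<bar>x\<bar>)"
proof -
  have *: "cyc_dist m y = min y (m - y)" if "0 \<le> y" "y \<le> m" for y
  proof (cases "y = 0 \<or> y = m")
    case False
    then have "(- y) mod m = m - y"
      using that by (simp add: zmod_zminus1_eq_if)
    then show ?thesis
      using False that by (simp add: cyc_dist_def)
  qed (use that in \<open>auto simp: cyc_dist_def\<close>)
  have "cyc_dist m x = cyc_dist m \<bar>x\<bar>"
    by (auto simp: cyc_dist_def abs_if min.commute)
  then show ?thesis
    using * assms by simp
qed

lemma cyc_dist_abs: "2 * \<bar>x\<bar> \<le> m \<Longrightarrow> cyc_dist m x = \<bar>x\<bar>"
  by (subst cyc_dist_eq) auto

lemma cyc_dist_minus: "cyc_dist m (- x) = cyc_dist m x"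
  by (simp add: cyc_dist_def min.commute)

lemma cyc_dist_diff_commute: "cyc_dist m (x - y) = cyc_dist m (y - x)"
  using cyc_dist_minus[of m "x - y"] by simp

lemma cyc_dist_sign: "\<bar>s\<bar> = 1 \<Longrightarrow> cyc_dist m (s * x) = cyc_dist m x"
  using cyc_dist_minus[of m x] by (auto simp: abs_if split: if_splits)

lemma cyc_dist_cong: "x mod m = y mod m \<Longrightarrow> cyc_dist m x = cyc_dist m y"
  unfolding cyc_dist_def by (metis mod_minus_eq)

lemma cyc_dist_nonneg: "0 < m \<Longrightarrow> 0 \<le> cyc_dist m x"
  by (simp add: cyc_dist_def)

lemma cyc_dist_le: "0 < m \<Longrightarrow> 2 * cyc_dist m x \<le> m"
  by (auto simp: cyc_dist_def zmod_zminus1_eq_if min_def)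

lemma cyc_dist_representative:
  assumes "0 < m"
  obtains s where "\<bar>s\<bar> = 1" "m dvd x - s * cyc_dist m x"
proof (cases "x mod m \<le> (- x) mod m")
  case True
  show ?thesis
    by (rule that[of 1]) (use True in \<open>auto simp: cyc_dist_def mod_0_imp_dvd min_def algebra_simps\<close>)
next
  case False
  have "m dvd - x - (- x) mod m"
    by (rule dvd_minus_mod)
  then have "m dvd x + (- x) mod m"
    by (metis add.commute dvd_minus_iff minus_add_distrib uminus_add_conv_diff)
  then show ?thesis
    by (intro that[of "-1"]) (use False in \<open>auto simp: cyc_dist_def\<close>)
qed

lemma cyc_dist_mod: "0 < m \<Longrightarrow> cyc_dist m x = min (x mod m) (m - x mod m)"
  using cyc_dist_cong[of x m "x mod m"] cyc_dist_eq[of "x mod m" m] by (simp add: less_imp_le)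

lemma cyc_dist_step_le:
  assumes "2 \<le> m" "\<bar>s\<bar> = 1"
  shows "cyc_dist m x \<le> cyc_dist m (x + s) + 1"
proof -
  have "cyc_dist m (x + s) = cyc_dist m (x mod m + s)"
    by (rule cyc_dist_cong) (simp add: mod_add_left_eq)
  moreover have "0 \<le> x mod m" "x mod m < m"
    using assms by simp_all
  ultimately show ?thesis
    using assms cyc_dist_mod[of m x] by (auto simp: cyc_dist_eq)
qed

lemma ex_cyc_dist_descent:
  assumes "0 < m" "cyc_dist m x \<noteq> 0"
  shows "\<exists>s. \<bar>s\<bar> = 1 \<and> cyc_dist m (x + s) = cyc_dist m x - 1"
proof -
  have *: "cyc_dist m (x + s) = cyc_dist m (x mod m + s)" for s
    by (rule cyc_dist_cong) (simp add: mod_add_left_eq)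
  define r where "r = x mod m"
  have r: "0 \<le> r" "r < m" "cyc_dist m x = min r (m - r)"
    using assms by (simp_all add: r_def cyc_dist_mod)
  show ?thesis
    using assms r unfolding * r_def[symmetric]
    \<comment> \<open>From the residue \<open>r\<close> the walk towards 0 goes down if that way is
      at most half the cycle, and otherwise up through \<open>m\<close>.\<close>
    by (intro exI[of _ "if 2 * r \<le> m then - 1 else 1"]) (auto simp: cyc_dist_eq)
qed

text \<open>In an even cycle every vertex lies on a geodesic from 0 to the opposite vertex.\<close>

lemma cyc_dist_antipode:
  assumes "even m" "0 \<le> x" "x < m"
  shows "cyc_dist m x + cyc_dist m (x - m div 2) = m div 2"
proof -
  obtain k where "m = 2 * k"
    using assms(1) ..
  then show ?thesis
    using assms by (auto simp: cyc_dist_eq)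
qed

section \<open>Shortest intervals on which a function takes three values\<close>

text \<open>An inner point sharing its value with an end could be used instead of that end, giving a
  shorter interval with three values.\<close>

lemma interior_of_minimal_arc:
  fixes f :: "int \<Rightarrow> 'a"
  assumes "a < b" "b < d" "distinct [f a, f b, f d]"
    and min: "\<And>x y z. x < y \<Longrightarrow> y < z \<Longrightarrow> distinct [f x, f y, f z] \<Longrightarrow> d - a \<le> z - x"
    and "a < w" "w < d"
  shows "f w \<noteq> f a \<and> f w \<noteq> f d"
  using assms(1-3,5,6) min[of w b d] min[of b w d] min[of a b w] min[of a w b]
  by (cases w b rule: linorder_cases) auto

text \<open>Minimality ranges over the whole family \<open>f\<close>, so a shorter arc in any other
  row is a contradiction as well.\<close>

lemma ex_minimal_arc:
  fixes f :: "'i \<Rightarrow> int \<Rightarrow> 'a"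
  assumes "distinct [f i a, f i b, f i d]"
  obtains i a b d where "a < b" "b < d" "distinct [f i a, f i b, f i d]"
    "\<And>j x y z. x < y \<Longrightarrow> y < z \<Longrightarrow> distinct [f j x, f j y, f j z] \<Longrightarrow> d - a \<le> z - x"
proof -
  define arc where "arc k \<longleftrightarrow> (\<exists>j x y z. x < y \<and> y < z \<and> distinct [f j x, f j y, f j z] \<and> k = nat (z - x))" for k
  have "\<exists>x y z. x < y \<and> y < z \<and> distinct [f i x, f i y, f i z]"
  proof -
    have ne: "a \<noteq> b" "a \<noteq> d" "b \<noteq> d"
      using assms by auto
    then consider "a < b" "b < d" | "a < d" "d < b" | "b < a" "a < d" | "b < d" "d < a"
      | "d < a" "a < b" | "d < b" "b < a"
      by linarith
    then show ?thesis
      by cases (use assms in \<open>fastforce\<close>)+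
  qed
  then have "\<exists>k. arc k"
    unfolding arc_def by blast
  then have L: "arc (Least arc)" "\<And>k. arc k \<Longrightarrow> Least arc \<le> k"
    by (auto intro: LeastI_ex Least_le)
  then obtain j x y z where *: "x < y" "y < z" "distinct [f j x, f j y, f j z]" "Least arc = nat (z - x)"
    unfolding arc_def by blast
  show thesis
  proof (rule that[OF *(1-3)])
    fix j' x' y' z' :: _
    assume "x' < y'" "y' < z'" "distinct [f j' x', f j' y', f j' z']"
    then have "arc (nat (z' - x'))"
      unfolding arc_def by blast
    with L(2)[OF this] * \<open>x' < y'\<close> \<open>y' < z'\<close> show "z - x \<le> z' - x'"
      by simp
  qed
qed

lemma ex_step_change:
  fixes f :: "int \<Rightarrow> 'a"
  assumes "f x \<noteq> f y"
  shows "\<exists>z. f z \<noteq> f (z + 1)"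
proof (rule ccontr)
  assume "\<not> ?thesis"
  then have step: "f (z + 1) = f z" for z
    by metis
  have "f (z + int k) = f z" for z k
  proof (induction k)
    case (Suc k)
    then show ?case
      using step[of "z + int k"] by (simp add: algebra_simps)
  qed simp
  from this[of x "nat (y - x)"] this[of y "nat (x - y)"] assms show False
    by (cases "x \<le> y") auto
qed

subsection \<open>Rainbow-free three-colorings\<close>

definition torus_dist :: "int \<Rightarrow> int \<Rightarrow> int \<Rightarrow> int \<Rightarrow> int \<Rightarrow> int \<Rightarrow> int" where
  "torus_dist m n x y x' y' = cyc_dist m (x - x') + cyc_dist n (y - y')"

lemma torus_dist_commute: "torus_dist m n x y x' y' = torus_dist m n x' y' x y"
  using cyc_dist_diff_commute by (simp add: torus_dist_def)

lemma torus_dist_affine: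
  assumes "\<bar>s\<bar> = 1" "\<bar>t\<bar> = 1"
  shows "torus_dist m n (a + s * x) (b + t * y) (a + s * x') (b + t * y') = torus_dist m n x y x' y'"
  using cyc_dist_sign[OF assms(1), of m "x - x'"] cyc_dist_sign[OF assms(2), of n "y - y'"]
  by (simp add: torus_dist_def algebra_simps)

text \<open>In \<open>no_rainbow\<close> the points may coincide modulo the periods: congruent
  points have equal colors, so the conclusion then holds anyway. The roles of axes and colors are
  interchangeable, which the next lemmas exploit through reinterpretation.\<close>

locale torus_coloring =
  fixes m n :: int and c :: "int \<Rightarrow> int \<Rightarrow> 'a" and R B G :: 'a
  assumes m: "3 \<le> m" and n: "3 \<le> n"
    and period_x: "\<And>x y. c (x + m) y = c x y"
    and period_y: "\<And>x y. c x (y + n) = c x y"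
    and colors_distinct: "R \<noteq> B" "B \<noteq> G" "R \<noteq> G"
    and colors: "\<And>x y. c x y = R \<or> c x y = B \<or> c x y = G"
    and no_rainbow: "\<And>x1 y1 x2 y2 x3 y3.
      torus_dist m n x1 y1 x2 y2 = torus_dist m n x2 y2 x3 y3 \<Longrightarrow>
      c x1 y1 = c x2 y2 \<or> c x2 y2 = c x3 y3 \<or> c x1 y1 = c x3 y3"
begin

lemma transposed: "torus_coloring n m (\<lambda>x y. c y x) R B G"
  by unfold_locales
    ((use colors in blast) | (use m n period_x period_y colors_distinct no_rainbow in \<open>auto simp: torus_dist_def add.commute\<close>))+

lemma rotate_colors: "torus_coloring m n c B G R"
  by unfold_locales
    ((use colors in blast) | (use m n period_x period_y colors_distinct no_rainbow in auto))+

lemma period_x': "c (x + m * k) y = c x y"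
proof -
  have nat: "c (x + m * int j) y = c x y" for j x
  proof (induction j)
    case (Suc j)
    then show ?case
      using period_x[of "x + m * int j" y] by (simp add: algebra_simps)
  qed simp
  show ?thesis
    using nat[of x "nat k"] nat[of "x + m * k" "nat (- k)"] by (cases "0 \<le> k") auto
qed

lemma cong_x: "m dvd x - x' \<Longrightarrow> c x y = c x' y"
  by (metis add.commute diff_add_cancel dvdE period_x')

lemma cong_y: "n dvd y - y' \<Longrightarrow> c x y = c x y'"
  using torus_coloring.cong_x[OF transposed] .

text \<open>Translations and reflections preserve \<open>torus_dist\<close>. Together with
  \<open>relative_position\<close> this puts one vertex at the origin and another at the nonnegative
  offset given by the cyclic distances.\<close>

lemma moved:
  assumes "\<bar>s\<bar> = 1" "\<bar>t\<bar> = 1"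
  shows "torus_coloring m n (\<lambda>x y. c (a + s * x) (b + t * y)) R B G"
proof unfold_locales
  fix x1 y1 x2 y2 x3 y3
  assume "torus_dist m n x1 y1 x2 y2 = torus_dist m n x2 y2 x3 y3"
  then show "c (a + s * x1) (b + t * y1) = c (a + s * x2) (b + t * y2) \<or>
    c (a + s * x2) (b + t * y2) = c (a + s * x3) (b + t * y3) \<or>
    c (a + s * x1) (b + t * y1) = c (a + s * x3) (b + t * y3)"
    by (intro no_rainbow) (simp only: torus_dist_affine[OF assms])
next
  fix x y
  show "c (a + s * (x + m)) (b + t * y) = c (a + s * x) (b + t * y)"
    by (rule cong_x) (simp add: algebra_simps)
  show "c (a + s * x) (b + t * (y + n)) = c (a + s * x) (b + t * y)"
    by (rule cong_y) (simp add: algebra_simps)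
qed (use m n colors_distinct colors in auto)

lemmas translated = moved[of 1 1, simplified]

section \<open>Rows and columns carry at most two colors\<close>

lemma row_not_trichromatic: "\<not> distinct [c x1 y, c x2 y, c x3 y]"
proof
  assume "distinct [c x1 y, c x2 y, c x3 y]"
  then obtain y0 x0 i0 k0 where arc: "x0 < i0" "i0 < k0"
      "distinct [c x0 y0, c i0 y0, c k0 y0]"
    and arc_min: "\<And>j x y z. x < y \<Longrightarrow> y < z \<Longrightarrow> distinct [c x j, c y j, c z j] \<Longrightarrow> k0 - x0 \<le> z - x"
    by (rule ex_minimal_arc[where f = "\<lambda>y x. c x y"]) (rule that)
  define d where "d x y = c (x0 + x) (y0 + y)" for x y
  interpret d: torus_coloring m n d R B G
    unfolding d_def by (rule translated)
  define i k where "i = i0 - x0" and "k = k0 - x0"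
  have i: "0 < i" "i < k" and tri: "distinct [d 0 0, d i 0, d k 0]"
    using arc by (auto simp: i_def k_def d_def)
  have min: "k \<le> z - x" if "x < y" "y < z" "distinct [d x j, d y j, d z j]" for j x y z
    using arc_min[of "x0 + x" "x0 + y" "x0 + z" "y0 + j"] that by (auto simp: d_def k_def)
  have inner: "d w 0 = d i 0" if "0 < w" "w < k" for w
    using interior_of_minimal_arc[of 0 i k "\<lambda>x. d x 0" w] i tri min that d.colors[of w 0] d.colors[of i 0]
      d.colors[of 0 0] d.colors[of k 0] by auto
  \<comment> \<open>The midpoint of an even arc has the inner color and is equidistant from both
    ends, a rainbow progression.\<close>
  have "odd k"
  proof
    assume "even k"
    then obtain h where h: "k = 2 * h" ..
    then have "d h 0 = d i 0"
      using i by (intro inner) auto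
    with d.no_rainbow[of 0 0 h 0 k 0] tri show False
      by (auto simp: torus_dist_def h cyc_dist_diff_commute[of m 0 h])
  qed
  with i have k: "3 \<le> k"
    by presburger
  \<comment> \<open>Distances along the arc must not wrap around. Since the color of 0 recurs at
    \<open>m\<close>, the positions \<open>k - 1\<close>, \<open>k\<close>, \<open>m\<close> form
    another trichromatic arc, and minimality gives 2k \<le> m + 1.\<close>
  have km: "2 * k \<le> m"
  proof -
    have dm: "d m 0 = d 0 0"
      using d.period_x[of 0 0] by simp
    have d1m: "d (m + 1) 0 = d 1 0"
      using d.period_x[of 1 0] by (simp add: add.commute)
    have "k < m"
      using inner[of m] dm tri m by (cases m k rule: linorder_cases) auto
    have tri1: "distinct [d (k - 1) 0, d k 0, d m 0]" and tri2: "distinct [d k 0, d m 0, d (m + 1) 0]"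
      using dm d1m inner[of "k - 1"] inner[of 1] k tri by auto
    have "k \<le> m - (k - 1)"
      using min[OF _ _ tri1] \<open>k < m\<close> by simp
    \<comment> \<open>In this case \<open>tri1\<close> and \<open>tri2\<close> are both shortest
      arcs, and \<open>k + 1\<close> is interior to both, which excludes all three colors
      there.\<close>
    moreover have "2 * k \<noteq> m + 1"
    proof
      assume eq: "2 * k = m + 1"
      then have "k + 1 < m"
        using k by simp
      have "d (k + 1) 0 \<noteq> d (k - 1) 0 \<and> d (k + 1) 0 \<noteq> d m 0"
        by (rule interior_of_minimal_arc[OF _ _ tri1]) (use min eq \<open>k + 1 < m\<close> in force)+
      moreover have "d (k + 1) 0 \<noteq> d k 0 \<and> d (k + 1) 0 \<noteq> d (m + 1) 0"
        by (rule interior_of_minimal_arc[OF _ _ tri2]) (use min eq \<open>k + 1 < m\<close> in force)+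
      ultimately show False
        using tri1 d.colors[of "k + 1" 0] d.colors[of "k - 1" 0] d.colors[of k 0] d.colors[of m 0]
        by auto
    qed
    ultimately show ?thesis
      by simp
  qed
  txt \<open>The adjacent row contains all three colors at the positions 0, 1 and \<open>k - 1\<close>.\<close>
  have dist: "cyc_dist m x = \<bar>x\<bar>" if "\<bar>x\<bar> \<le> k" for x
    using that km by (intro cyc_dist_abs) simp
  have dist1: "cyc_dist n x = \<bar>x\<bar>" if "\<bar>x\<bar> \<le> 1" for x
    using that n by (intro cyc_dist_abs) simp
  obtain h where h: "k = 2 * h + 1"
    using \<open>odd k\<close> by (elim oddE)
  have in1: "d 1 0 = d i 0" and in2: "d (k - 1) 0 = d i 0" and in3: "d h 0 = d i 0"
    using k h by (auto intro: inner)
  \<comment> \<open>As k = 2h + 1, the point (h, 0) is at distance h + 1 from both (0, 1) and (k,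
    0). In \<open>a\<close>, \<open>b\<close> and \<open>e\<close> alike, one long progression and
    one around a corner leave a single color.\<close>
  have a: "d 0 1 = d i 0"
    using d.no_rainbow[of 0 1 h 0 k 0] d.no_rainbow[of 0 1 0 0 1 0] tri k in1 in3 h
    by (auto simp: torus_dist_def dist dist1)
  have b: "d (k - 1) 1 = d k 0"
    using d.no_rainbow[of "k - 1" 1 0 0 k 0] d.no_rainbow[of "k - 1" 1 "k - 1" 0 k 0] tri k in2
    by (auto simp: torus_dist_def dist dist1)
  have e: "d 1 1 = d 0 0"
    using d.no_rainbow[of 1 1 k 0 0 0] d.no_rainbow[of 1 1 1 0 0 0] tri k in1
    by (auto simp: torus_dist_def dist dist1)
  show False
    using min[of 0 1 "k - 1" 1] a b e tri k by auto
qed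

lemma column_not_trichromatic: "\<not> distinct [c x y1, c x y2, c x y3]"
  using torus_coloring.row_not_trichromatic[OF transposed] .

lemma cyc_dist_1 [simp]: "cyc_dist m 1 = 1" "cyc_dist m (- 1) = 1" "cyc_dist n 1 = 1" "cyc_dist n (- 1) = 1"
  and cyc_dist_0 [simp]: "cyc_dist m 0 = 0" "cyc_dist n 0 = 0"
  using m n by (simp_all add: cyc_dist_abs)

lemma relative_position:
  obtains s t where "\<bar>s\<bar> = 1" "\<bar>t\<bar> = 1"
    "c x' y' = c (x + s * cyc_dist m (x - x')) (y + t * cyc_dist n (y - y'))"
proof -
  have "0 < m" "0 < n"
    using m n by auto
  obtain s where s: "\<bar>s\<bar> = 1" "m dvd x' - x - s * cyc_dist m (x' - x)"
    using cyc_dist_representative[OF \<open>0 < m\<close>] .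
  obtain t where t: "\<bar>t\<bar> = 1" "n dvd y' - y - t * cyc_dist n (y' - y)"
    using cyc_dist_representative[OF \<open>0 < n\<close>] .
  have "c x' y' = c (x + s * cyc_dist m (x' - x)) (y + t * cyc_dist n (y' - y))"
    using cong_x s(2) cong_y t(2) by (metis diff_diff_eq)
  then show thesis
    using that s(1) t(1) by (simp add: cyc_dist_diff_commute)
qed

section \<open>Monochromatic rows\<close>

text \<open>Row \<open>y\<close> has an edge joining its two colors. If row \<open>y'\<close> were
  all \<open>S\<close>, the two columns through this edge would contain \<open>S\<close>; the
  progression around a corner and the two-color bound for columns then copy the edge upwards row by
  row until it reaches row \<open>y'\<close>.\<close>

lemma row_not_monochromatic:
  assumes "c x y \<noteq> c x' y" "c x y \<noteq> S" "c x' y \<noteq> S"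
  shows "\<exists>z. c z y' \<noteq> S"
proof (rule ccontr)
  assume "\<not> ?thesis"
  then have mono: "c z y' = S" for z
    by blast
  obtain z where z: "c z y \<noteq> c (z + 1) y"
    using ex_step_change[where f = "\<lambda>x. c x y"] assms by blast
  have S: "c w y \<noteq> S" for w
    using row_not_trichromatic[of x y x' w] assms by auto
  have "c z (y + int j) = c z y \<and> c (z + 1) (y + int j) = c (z + 1) y" for j
  proof (induction j)
    case (Suc j)
    have "c z (y + int j + 1) = c z y"
      using no_rainbow[of z "y + int j + 1" z "y + int j" "z + 1" "y + int j"] Suc z S[of z] S[of "z + 1"]
        column_not_trichromatic[of z y "y + int j + 1" y'] mono[of z]
      by (auto simp: torus_dist_def)
    moreover have "c (z + 1) (y + int j + 1) = c (z + 1) y"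
      using no_rainbow[of "z + 1" "y + int j + 1" "z + 1" "y + int j" z "y + int j"] Suc z S[of z] S[of "z + 1"]
        column_not_trichromatic[of "z + 1" y "y + int j + 1" y'] mono[of "z + 1"]
      by (auto simp: torus_dist_def)
    ultimately show ?case
      by (simp add: algebra_simps)
  qed simp
  from this[of "nat ((y' - y) mod n)"] have "c z (y + (y' - y) mod n) = c z y"
    using n by simp
  moreover have "c z (y + (y' - y) mod n) = c z y'"
    by (rule cong_y) (metis diff_diff_eq dvd_minus_iff dvd_minus_mod minus_diff_eq)
  ultimately show False
    using mono S by metis
qed

text \<open>The progression around a corner gives the next vertex of either row color
  \<open>P\<close> or \<open>Q\<close>, and the missing color decides which; so the edge spreads
  around both rows.\<close>

lemma vertical_edge_between_rows:
  assumes "\<bar>y - y'\<bar> = 1" "c x y = P" "c x y' = Q" "P \<noteq> Q"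
    and "\<And>z. c z y \<noteq> Q" "\<And>z. c z y' \<noteq> P"
  shows "c z y = P \<and> c z y' = Q"
proof -
  have vert: "cyc_dist n (y - y') = 1" "cyc_dist n (y' - y) = 1"
    using assms(1) n cyc_dist_abs[of "y - y'" n] cyc_dist_abs[of "y' - y" n]
    by (auto simp: abs_minus_commute)
  have "c (x + int j) y = P \<and> c (x + int j) y' = Q" for j
  proof (induction j)
    case (Suc j)
    then show ?case
      using no_rainbow[of "x + int j + 1" y "x + int j" y "x + int j" y']
        no_rainbow[of "x + int j + 1" y' "x + int j" y' "x + int j" y] vert assms(4-6)
      by (auto simp: torus_dist_def add.assoc add.commute[of 1])
  qed (use assms in simp)
  from this[of "nat ((z - x) mod m)"]
  have "c (x + (z - x) mod m) y = P \<and> c (x + (z - x) mod m) y' = Q"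
    using m by simp
  moreover have "c (x + (z - x) mod m) w = c z w" for w
    by (rule cong_x) (metis diff_diff_eq dvd_minus_iff dvd_minus_mod minus_diff_eq)
  ultimately show ?thesis
    by metis
qed

text \<open>
  If no row were monochromatic, each row would miss exactly one color. In a shortest run of rows
  missing all three colors, following one column through the run leads to a vertical edge between
  two adjacent rows whose missing colors are the colors of its endpoints.
\<close>

lemma ex_monochromatic_row:
  assumes "\<And>S. S \<in> {R, B, G} \<Longrightarrow> \<exists>y. \<forall>x. c x y \<noteq> S"
  shows "\<exists>y S. \<forall>x. c x y = S"
proof (rule ccontr)
  assume "\<not> ?thesis"
  then have bi: "\<exists>x. c x y \<noteq> S" for y S
    by blast
  define missing where "missing y = (SOME S. S \<in> {R, B, G} \<and> (\<forall>x. c x y \<noteq> S))" for y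
  have missing: "missing y \<in> {R, B, G} \<and> (\<forall>x. c x y \<noteq> missing y)" for y
    unfolding missing_def
  proof (rule someI_ex, rule ccontr)
    assume "\<nexists>S. S \<in> {R, B, G} \<and> (\<forall>x. c x y \<noteq> S)"
    then obtain x1 x2 x3 where "c x1 y = R" "c x2 y = B" "c x3 y = G"
      by (metis insertCI)
    with row_not_trichromatic[of x1 y x2 x3] colors_distinct show False
      by auto
  qed
  have present: "\<exists>x. c x y = P" if "P \<in> {R, B, G}" "P \<noteq> missing y" for y P
  proof (rule ccontr)
    assume "\<not> ?thesis"
    moreover obtain x where "c x y \<noteq> c 0 y"
      using bi by blast
    ultimately show False
      using that missing[of y] colors[of x y] colors[of 0 y] by auto
  qed
  have missing_eq: "missing y = S" if "S \<in> {R, B, G}" "\<forall>x. c x y \<noteq> S" for S y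
    using present[OF that(1)] that(2) by metis
  obtain y1 y2 y3 where "missing y1 = R" "missing y2 = B" "missing y3 = G"
    using assms[of R] assms[of B] assms[of G] missing_eq by (metis insertCI)
  then have "distinct [missing y1, missing y2, missing y3]"
    using colors_distinct by simp
  then obtain a b d where arc: "a < b" "b < d" "distinct [missing a, missing b, missing d]"
    and arc_min: "\<And>x y z. x < y \<Longrightarrow> y < z \<Longrightarrow> distinct [missing x, missing y, missing z] \<Longrightarrow> d - a \<le> z - x"
    using ex_minimal_arc[where f = "\<lambda>_::unit. missing"] by metis
  have missing_color: "missing y = R \<or> missing y = B \<or> missing y = G" for y
    using missing by blast
  have distinct: "missing a \<noteq> missing b" "missing a \<noteq> missing d" "missing b \<noteq> missing d"
    using arc(3) by auto
  have all_missing: "S = missing a \<or> S = missing b \<or> S = missing d" if "S = R \<or> S = B \<or> S = G" for S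
    using that missing_color[of a] missing_color[of b] missing_color[of d] distinct by metis
  have inner: "missing w = missing b" if "a < w" "w < d" for w
  proof -
    have "missing w \<noteq> missing a \<and> missing w \<noteq> missing d"
      by (rule interior_of_minimal_arc[of a b d missing, OF arc arc_min that])
    then show ?thesis
      using all_missing[OF missing_color] by blast
  qed
  have others: "c x y = missing a \<or> c x y = missing b \<or> c x y = missing d" for x y
    using all_missing[OF colors] .
  have first: "missing (a + 1) = missing b" and last: "missing (d - 1) = missing b"
    using arc by (auto intro: inner)
  obtain x where x: "c x a = missing b"
    using present[of "missing b" a] missing[of b] arc(3) by auto
  \<comment> \<open>The other candidate is \<open>missing a\<close>; that edge would spread and make
    row \<open>a\<close> monochromatic.\<close>
  have "c x (a + 1) = missing d"
  proof (rule ccontr)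
    assume "c x (a + 1) \<noteq> missing d"
    then have "c x (a + 1) = missing a"
      using others[of x "a + 1"] missing[of "a + 1"] first by metis
    then have "c z a = missing b" for z
      using vertical_edge_between_rows[of a "a + 1" x "missing b" "missing a" z] x arc(3) missing[of a]
        missing[of "a + 1"] first by auto
    then show False
      using present[of "missing d" a] missing[of d] arc(3) by auto
  qed
  \<comment> \<open>Column \<open>x\<close> now has its two colors, \<open>missing b\<close> and
    \<open>missing d\<close>. This determines its edge at the far end of the run, and that edge
    spreads along rows \<open>d - 1\<close> and \<open>d\<close>.\<close>
  then have not_a: "c x y \<noteq> missing a" for y
    using column_not_trichromatic[of x a "a + 1" y] x arc(3) by auto
  have "c x (d - 1) = missing d"
    using others[of x "d - 1"] not_a last missing[of "d - 1"] by metis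
  moreover have "c x d = missing b"
    using others[of x d] not_a missing[of d] by metis
  ultimately have "c z (d - 1) = missing d" for z
    using vertical_edge_between_rows[of "d - 1" d x "missing d" "missing b" z] arc(3) missing[of d]
      missing[of "d - 1"] last by auto
  then show False
    using present[of "missing a" "d - 1"] missing[of a] last arc(3) by auto
qed

section \<open>Two colors that are nowhere adjacent\<close>

definition adjacent :: "'a \<Rightarrow> 'a \<Rightarrow> bool" where
  "adjacent P Q \<longleftrightarrow> (\<exists>x y x' y'. torus_dist m n x y x' y' = 1 \<and> c x y = P \<and> c x' y' = Q)"

definition share_row :: "'a \<Rightarrow> 'a \<Rightarrow> bool" where
  "share_row P Q \<longleftrightarrow> (\<exists>x x' y. c x y = P \<and> c x' y = Q)"

definition share_column :: "'a \<Rightarrow> 'a \<Rightarrow> bool" where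
  "share_column P Q \<longleftrightarrow> (\<exists>x y y'. c x y = P \<and> c x y' = Q)"

lemma share_row_commute: "share_row P Q \<longleftrightarrow> share_row Q P"
  unfolding share_row_def by blast

lemma share_column_commute: "share_column P Q \<longleftrightarrow> share_column Q P"
  unfolding share_column_def by blast

lemma adjacent_commute: "adjacent P Q \<longleftrightarrow> adjacent Q P"
  unfolding adjacent_def by (metis torus_dist_commute)

lemma adjacentE:
  assumes "adjacent P Q"
  obtains x y s where "c x y = P" "\<bar>s\<bar> = 1" "c (x + s) y = Q"
    | x y t where "c x y = P" "\<bar>t\<bar> = 1" "c x (y + t) = Q"
proof -
  obtain x y x' y' where *: "torus_dist m n x y x' y' = 1" "c x y = P" "c x' y' = Q"
    using assms unfolding adjacent_def by blast
  obtain s t where st: "\<bar>s\<bar> = 1" "\<bar>t\<bar> = 1"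
    "c x' y' = c (x + s * cyc_dist m (x - x')) (y + t * cyc_dist n (y - y'))"
    by (rule relative_position)
  have "cyc_dist m (x - x') = 1 \<and> cyc_dist n (y - y') = 0 \<or> cyc_dist m (x - x') = 0 \<and> cyc_dist n (y - y') = 1"
    using *(1) cyc_dist_nonneg[of m "x - x'"] cyc_dist_nonneg[of n "y - y'"] m n
    unfolding torus_dist_def by linarith
  then show thesis
    using that * st by auto
qed

lemma adjacent_imp_share: "adjacent P Q \<Longrightarrow> share_row P Q \<or> share_column P Q"
  by (elim adjacentE) (auto simp: share_row_def share_column_def)

text \<open>By \<open>row_not_monochromatic\<close> no row is all \<open>B\<close> or all
  \<open>G\<close>, so a row without \<open>R\<close> would contain both. Then every pair of colors
  shares a row, so each color is missing from some row while none is monochromatic, against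
  \<open>ex_monochromatic_row\<close>. Hence \<open>R\<close> is in every row, no row has both
  \<open>B\<close> and \<open>G\<close>, and a vertical edge between them would spread to a row
  without \<open>R\<close>.\<close>

lemma not_adjacent_if_share_row:
  assumes "share_row R B" "share_row R G"
  shows "\<not> adjacent B G"
proof
  assume "adjacent B G"
  have bi: "\<exists>x. c x y \<noteq> S" if "share_row P Q" "P \<noteq> Q" "Q \<noteq> S" "P \<noteq> S" for P Q S y
    using that row_not_monochromatic unfolding share_row_def by metis
  have R: "\<exists>x. c x y = R" for y
  proof (rule ccontr)
    assume no_R: "\<not> ?thesis"
    have not_B: "\<exists>x. c x z \<noteq> B" and not_G: "\<exists>x. c x z \<noteq> G" for z
      using bi assms colors_distinct by metis+
    have "share_row B G"
      using not_B[of y] not_G[of y] no_R colors unfolding share_row_def by metis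
    then have not_R: "\<exists>x. c x z \<noteq> R" for z
      using bi colors_distinct by metis
    have "\<exists>y. \<forall>x. c x y \<noteq> S" if S: "S \<in> {R, B, G}" for S
    proof -
      obtain P Q where "share_row P Q" "distinct [P, Q, S]"
        using S assms \<open>share_row B G\<close> colors_distinct by auto
      then show ?thesis
        using row_not_trichromatic unfolding share_row_def by (metis distinct_length_2_or_more distinct_singleton)
    qed
    from ex_monochromatic_row[OF this] show False
      using not_B not_G not_R colors by metis
  qed
  from \<open>adjacent B G\<close> show False
  proof (cases rule: adjacentE)
    case (1 x y s)
    then show False
      using R[of y] row_not_trichromatic colors_distinct
      by (metis distinct_length_2_or_more distinct_singleton)
  next
    case (2 x y t)
    have "c z y \<noteq> G" "c z (y + t) \<noteq> B" for z
      using R[of y] R[of "y + t"] 2 row_not_trichromatic colors_distinct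
      by (metis distinct_length_2_or_more distinct_singleton)+
    then have "c z y = B" for z
      using vertical_edge_between_rows[of y "y + t" x B G z] 2 colors_distinct by auto
    then show False
      using R[of y] colors_distinct by auto
  qed
qed

lemma not_adjacent_if_share_column:
  assumes "share_column R B" "share_column R G"
  shows "\<not> adjacent B G"
proof -
  interpret t: torus_coloring n m "\<lambda>x y. c y x" R B G
    by (rule transposed)
  have "t.share_row = share_column"
    unfolding fun_eq_iff t.share_row_def share_column_def by blast
  moreover have "t.adjacent B G \<longleftrightarrow> adjacent B G"
    unfolding t.adjacent_def adjacent_def torus_dist_def by (subst add.commute) blast
  ultimately show ?thesis
    using t.not_adjacent_if_share_row assms by simp
qed

text \<open>If all three pairs were adjacent, two of them would share a line in the same direction.
  These two pairs have a color in common, and the remaining two colors cannot be adjacent.\<close>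

lemma nonadjacent_pair: "\<not> adjacent R B \<or> \<not> adjacent R G \<or> \<not> adjacent B G"
proof -
  interpret b: torus_coloring m n c B G R
    by (rule rotate_colors)
  interpret g: torus_coloring m n c G R B
    by (rule b.rotate_colors)
  show ?thesis
    using not_adjacent_if_share_row b.not_adjacent_if_share_row g.not_adjacent_if_share_row
      not_adjacent_if_share_column b.not_adjacent_if_share_column g.not_adjacent_if_share_column
      adjacent_imp_share adjacent_commute share_row_commute share_column_commute
    by metis
qed

section \<open>Closest vertices of two nonadjacent colors\<close>

text \<open>
  The closest pair is chosen with maximal vertical offset \<open>b\<close>, so that it cannot be moved diagonally
  towards the vertical direction; this leaves only \<open>a = 0\<close> or \<open>b = n div 2\<close> to be refuted.
\<close>

lemma antipodal_if_extremal:
  assumes origin: "c 0 0 = B" and target: "c a b = G"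
    and a: "0 \<le> a" "2 * a \<le> m" and b: "0 \<le> b" "2 * b \<le> n"
    and apart: "2 \<le> a + b"
    and closest: "\<And>x y x' y'. c x y = B \<Longrightarrow> c x' y' = G \<Longrightarrow> a + b \<le> torus_dist m n x y x' y'"
    and steepest: "\<And>x y x' y'. c x y = B \<Longrightarrow> c x' y' = G \<Longrightarrow> torus_dist m n x y x' y' = a + b \<Longrightarrow>
      cyc_dist n (y - y') \<le> b"
  shows "m = 2 * a \<and> n = 2 * b \<and> odd (a + b)"
proof -
  note dist = torus_dist_def cyc_dist_eq
  \<comment> \<open>The two propagation rules are stated for every closest pair, since a later step
    applies one to a pair obtained by propagation.\<close>
  have G: "c x'' y'' = G" if "c x y = B" "c x' y' = G" "torus_dist m n x y x' y' = a + b"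
    "torus_dist m n x y x'' y'' = a + b" "torus_dist m n x'' y'' x' y' < a + b" for x y x' y' x'' y''
    using no_rainbow[of x' y' x y x'' y''] closest[of x'' y'' x' y'] that colors_distinct
    by (auto simp: torus_dist_commute[of m n x' y' x y])
  have B: "c x'' y'' = B" if "c x y = B" "c x' y' = G" "torus_dist m n x y x' y' = a + b"
    "torus_dist m n x'' y'' x' y' = a + b" "torus_dist m n x y x'' y'' < a + b" for x y x' y' x'' y''
    using no_rainbow[of x y x' y' x'' y''] closest[of x y x'' y''] that colors_distinct
    by (auto simp: torus_dist_commute[of m n x' y' x'' y''])
  have ab: "torus_dist m n 0 0 a b = a + b"
    using a b by (simp add: dist)
  have odd: "odd (a + b)"
  proof
    assume "even (a + b)"
    then obtain h where h: "a + b = 2 * h" ..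
    \<comment> \<open>The midpoint of the geodesic that first runs horizontally and then
      vertically.\<close>
    define a' b' where "a' = min a h" and "b' = h - a'"
    have half: "torus_dist m n 0 0 a' b' = h" "torus_dist m n a' b' a b = h"
      using a b h by (auto simp: dist a'_def b'_def)
    then show False
      using no_rainbow[of 0 0 a' b' a b] closest[of 0 0 a' b'] closest[of a' b' a b] origin target
        colors_distinct h apart by auto
  qed
  have k: "3 \<le> a + b"
    using odd apart by presburger
  have "1 \<le> a"
  proof (rule ccontr)
    assume "\<not> 1 \<le> a"
    then have [simp]: "a = 0"
      using a by simp
    \<comment> \<open>Both ends move one column sideways and one step towards each other; each stays
      at distance \<open>b\<close> from the old opposite end.\<close>
    have "c 1 (b - 1) = G"
      by (rule G[OF origin target ab]) (use m b k in \<open>simp_all add: dist\<close>)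
    moreover have "c 1 1 = B"
      by (rule B[OF origin target ab]) (use m b k in \<open>simp_all add: dist\<close>)
    ultimately show False
      using closest[of 1 1 1 "b - 1"] b k by (simp add: dist)
  qed
  have "n < 2 * (b + 1)"
  proof (rule ccontr)
    assume n': "\<not> ?thesis"
    have "c (a - 1) (b + 1) = G"
      by (rule G[OF origin target ab]) (use \<open>1 \<le> a\<close> a b k n' in \<open>simp_all add: dist\<close>)
    then show False
      using steepest[OF origin, of "a - 1" "b + 1"] \<open>1 \<le> a\<close> a b k n' by (simp add: dist)
  qed
  have "n \<noteq> 2 * b + 1"
  proof
    assume n': "n = 2 * b + 1"
    then have "1 \<le> b"
      using n by simp
    \<comment> \<open>On an odd cycle \<open>b\<close> and \<open>b + 1\<close> are equally far from
      0. Moving both ends outwards by one brings them closer round the back.\<close>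
    have "c a (b + 1) = G"
      by (rule G[OF origin target ab]) (use a \<open>1 \<le> b\<close> k n' in \<open>simp_all add: dist\<close>)
    moreover have "c 0 (- 1) = B"
      by (rule B[OF origin target ab]) (use a \<open>1 \<le> b\<close> k n' in \<open>simp_all add: dist\<close>)
    ultimately show False
      using closest[of 0 "- 1" a "b + 1"] a \<open>1 \<le> b\<close> k n' by (simp add: dist)
  qed
  then have n': "n = 2 * b"
    using \<open>n < 2 * (b + 1)\<close> b by simp
  then have "2 \<le> b"
    using n by simp
  have "m \<noteq> 2 * a + 1"
  proof
    assume m': "m = 2 * a + 1"
    have "c (a + 1) b = G"
      by (rule G[OF origin target ab]) (use \<open>1 \<le> a\<close> b k m' in \<open>simp_all add: dist\<close>)
    moreover have "c (- 1) 0 = B"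
      by (rule B[OF origin target ab]) (use \<open>1 \<le> a\<close> b k m' in \<open>simp_all add: dist\<close>)
    ultimately show False
      using closest[of "- 1" 0 "a + 1" b] \<open>1 \<le> a\<close> b k m' by (simp add: dist)
  qed
  moreover have "m < 2 * (a + 1)"
  proof (rule ccontr)
    assume m': "\<not> ?thesis"
    \<comment> \<open>Since n = 2b, the point (a - 1, b + 1) is too close to the origin for the rule
      \<open>G\<close> to apply from there; it is at the right distance from (-1, 1).\<close>
    have left: "c (- 1) 1 = B"
      by (rule B[OF origin target ab]) (use \<open>1 \<le> a\<close> \<open>2 \<le> b\<close> k m' n' in \<open>simp_all add: dist\<close>)
    have "c (a - 1) (b + 1) = G"
      by (rule G[OF left target]) (use \<open>1 \<le> a\<close> \<open>2 \<le> b\<close> k m' n' in \<open>simp_all add: dist\<close>)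
    then show False
      using closest[OF origin, of "a - 1" "b + 1"] \<open>1 \<le> a\<close> \<open>2 \<le> b\<close> a k m' n' by (simp add: dist)
  qed
  ultimately show ?thesis
    using a n' odd by auto
qed

text \<open>A pair of least distance, and among these of greatest vertical offset, is moved into the
  position of \<open>antipodal_if_extremal\<close>. The least distance then equals the largest
  possible one, so every pair attains it.\<close>

lemma antipodal_if_not_adjacent:
  assumes "\<not> adjacent B G" "\<exists>x y. c x y = B" "\<exists>x y. c x y = G"
  shows "even m \<and> even n \<and> odd (m div 2 + n div 2) \<and>
    (\<forall>x y x' y'. c x y = B \<longrightarrow> c x' y' = G \<longrightarrow> torus_dist m n x y x' y' = m div 2 + n div 2)"
proof -
  define pairs where "pairs = {(x, y, x', y'). c x y = B \<and> c x' y' = G}"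
  define dist where "dist = (\<lambda>(x, y, x', y'). torus_dist m n x y x' y')"
  define height where "height = (\<lambda>(x :: int, y, x' :: int, y'). cyc_dist n (y - y'))"
  have nonneg: "0 \<le> cyc_dist m x" "0 \<le> cyc_dist n x" for x
    using cyc_dist_nonneg m n by simp_all
  have dist_nonneg: "0 \<le> dist q" and height_nonneg: "0 \<le> height q" for q
    using nonneg by (auto simp: dist_def height_def torus_dist_def split: prod.split)
  obtain q0 where "q0 \<in> pairs"
    using assms(2,3) unfolding pairs_def by blast
  then obtain q1 where q1: "q1 \<in> pairs" "\<And>q. q \<in> pairs \<Longrightarrow> nat (dist q1) \<le> nat (dist q)"
    using ex_has_least_nat[of "\<lambda>q. q \<in> pairs" q0 "\<lambda>q. nat (dist q)"] by blast
  obtain q2 where q2: "q2 \<in> pairs" "dist q2 = dist q1"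
    "\<And>q. q \<in> pairs \<Longrightarrow> dist q = dist q1 \<Longrightarrow> nat (height q) \<le> nat (height q2)"
  proof -
    have "cyc_dist n x \<le> n" for x
      using cyc_dist_le[of n x] n nonneg(2)[of x] by simp
    then have "height q \<le> n" for q
      by (cases q) (simp add: height_def)
    then have "nat (height q) < nat (n + 1)" for q
      using n by (simp add: le_less_trans nat_less_iff[OF height_nonneg])
    then show thesis
      using ex_has_greatest_nat[of "\<lambda>q. q \<in> pairs \<and> dist q = dist q1" q1 "\<lambda>q. nat (height q)" "nat (n + 1)"]
        q1(1) that by (metis less_imp_le)
  qed
  obtain x0 y0 x1 y1 where q2_eq: "q2 = (x0, y0, x1, y1)"
    by (cases q2)
  define a b where "a = cyc_dist m (x0 - x1)" and "b = cyc_dist n (y0 - y1)"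
  have uv: "c x0 y0 = B" "c x1 y1 = G"
    using q2(1) by (simp_all add: q2_eq pairs_def)
  obtain s t where st: "\<bar>s\<bar> = 1" "\<bar>t\<bar> = 1" and G: "c x1 y1 = c (x0 + s * a) (y0 + t * b)"
    unfolding a_def b_def by (rule relative_position)
  have closest: "a + b \<le> torus_dist m n x y x' y'" if "c x y = B" "c x' y' = G" for x y x' y'
    using q1(2)[of "(x, y, x', y')"] q2(2) that dist_nonneg[of "(x, y, x', y')"]
    by (simp add: pairs_def dist_def q2_eq a_def b_def torus_dist_def)
  have steepest: "cyc_dist n (y - y') \<le> b"
    if "c x y = B" "c x' y' = G" "torus_dist m n x y x' y' = a + b" for x y x' y'
    using q2(2) q2(3)[of "(x, y, x', y')"] that nonneg
    by (simp add: nat_le_iff pairs_def dist_def height_def q2_eq a_def b_def torus_dist_def)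
  have "a + b \<noteq> 0"
  proof
    assume "a + b = 0"
    then have "a = 0" "b = 0"
      using nonneg by (simp_all add: a_def b_def add_nonneg_eq_0_iff)
    then show False
      using uv G colors_distinct by simp
  qed
  moreover have "a + b \<noteq> 1"
    using assms(1) uv by (auto simp: adjacent_def a_def b_def torus_dist_def)
  ultimately have apart: "2 \<le> a + b"
    using nonneg[of "x0 - x1"] nonneg[of "y0 - y1"] unfolding a_def b_def by linarith
  interpret d: torus_coloring m n "\<lambda>x y. c (x0 + s * x) (y0 + t * y)" R B G
    using st by (rule moved)
  have "m = 2 * a \<and> n = 2 * b \<and> odd (a + b)"
  proof (rule d.antipodal_if_extremal)
    fix x y x' y'
    assume *: "c (x0 + s * x) (y0 + t * y) = B" "c (x0 + s * x') (y0 + t * y') = G"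
    show "a + b \<le> torus_dist m n x y x' y'"
      using closest[OF *] by (simp add: torus_dist_affine[OF st])
    assume "torus_dist m n x y x' y' = a + b"
    then show "cyc_dist n (y - y') \<le> b"
      using steepest[OF *] cyc_dist_sign[OF st(2), of n "y - y'"]
      by (simp add: torus_dist_affine[OF st] right_diff_distrib)
  qed (use uv G nonneg cyc_dist_le m n apart in \<open>simp_all add: a_def b_def\<close>)
  moreover have "torus_dist m n x y x' y' \<le> a + b" if "m = 2 * a" "n = 2 * b" for x y x' y'
    using cyc_dist_le[of m "x - x'"] cyc_dist_le[of n "y - y'"] m n that
    by (simp add: torus_dist_def)
  ultimately show ?thesis
    using closest by (auto intro!: antisym)
qed

lemma antipodal_pair:
  assumes "\<exists>x y. c x y = R" "\<exists>x y. c x y = B" "\<exists>x y. c x y = G"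
  shows "even m \<and> even n \<and> odd (m div 2 + n div 2) \<and>
    (\<exists>P Q. P \<in> {R, B, G} \<and> Q \<in> {R, B, G} \<and> P \<noteq> Q \<and>
      (\<forall>x y x' y'. c x y = P \<longrightarrow> c x' y' = Q \<longrightarrow> torus_dist m n x y x' y' = m div 2 + n div 2))"
proof -
  interpret b: torus_coloring m n c B G R
    by (rule rotate_colors)
  interpret g: torus_coloring m n c G R B
    by (rule b.rotate_colors)
  show ?thesis
    using nonadjacent_pair antipodal_if_not_adjacent b.antipodal_if_not_adjacent
      g.antipodal_if_not_adjacent assms colors_distinct adjacent_commute
    by (metis insertCI)
qed

end

subsection \<open>The torus graph\<close>

text \<open>A potential argument: \<open>d\<close> drops by at most 1 along an arc, so every walk to
  \<open>v\<close> costs at least \<open>d u\<close>, and following descents gives a walk of exactly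
  that cost.\<close>

lemma gdist_eqI:
  fixes d :: "'a \<Rightarrow> nat"
  assumes "pair_graph H" and "u \<in> pverts H" "v \<in> pverts H" and "d v = 0"
    and arc: "\<And>x y. (x, y) \<in> parcs H \<Longrightarrow> d x \<le> d y + 1"
    and descent: "\<And>x. x \<in> pverts H \<Longrightarrow> x \<noteq> v \<Longrightarrow> \<exists>y. (x, y) \<in> parcs H \<and> d x = Suc (d y)"
  shows "gdist H u v = ereal (real (d u))"
proof -
  interpret H: pair_graph H
    by fact
  have lower: "real (d x) \<le> H.awalk_cost (\<lambda>_. 1) p" if "H.awalk x p v" for x p
    using that
  proof (induction p arbitrary: x)
    case Nil
    then show ?case
      using \<open>d v = 0\<close> by (simp add: H.awalk_Nil_iff)
  next
    case (Cons e p)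
    then obtain y where "(x, y) \<in> parcs H" "H.awalk y p v"
      by (cases e) (auto simp: H.awalk_Cons_iff)
    then show ?case
      using arc[of x y] Cons.IH[of y] by simp
  qed
  have upper: "\<exists>p. H.awalk x p v \<and> H.awalk_cost (\<lambda>_. 1) p = real (d x)" if "x \<in> pverts H" for x
    using that
  proof (induction "d x" arbitrary: x rule: less_induct)
    case less
    show ?case
    proof (cases "x = v")
      case True
      then show ?thesis
        using \<open>d v = 0\<close> \<open>v \<in> pverts H\<close> by (intro exI[of _ "[]"]) (simp add: H.awalk_Nil_iff)
    next
      case False
      then obtain y where y: "(x, y) \<in> parcs H" "d x = Suc (d y)"
        using descent less.prems by blast
      then have "y \<in> pverts H"
        using H.wellformed'[of x y] by blast
      then obtain p where "H.awalk y p v" "H.awalk_cost (\<lambda>_. 1) p = real (d y)"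
        using less.hyps[of y] y by auto
      then show ?thesis
        using y less.prems by (intro exI[of _ "(x, y) # p"]) (simp add: H.awalk_Cons_iff)
    qed
  qed
  show ?thesis
    unfolding gdist_def
  proof (rule antisym)
    show "H.\<mu> (\<lambda>_. 1) u v \<le> ereal (real (d u))"
      using upper[OF \<open>u \<in> pverts H\<close>] H.min_cost_le_walk_cost by metis
    show "ereal (real (d u)) \<le> H.\<mu> (\<lambda>_. 1) u v"
      unfolding H.\<mu>_def by (rule INF_greatest) (use lower in simp)
  qed
qed

lemma ex_exact_coloring:
  assumes "finite (pverts H)" "1 \<le> r" "r \<le> card (pverts H)"
  shows "\<exists>c. exact_coloring H r c"
proof -
  obtain f where f: "bij_betw f (pverts H) {0..<card (pverts H)}"
    using ex_bij_betw_finite_nat[OF assms(1)] by blast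
  have "(\<lambda>v. min (f v + 1) r) ` pverts H = (\<lambda>k. min (k + 1) r) ` f ` pverts H"
    by (simp add: image_image)
  also have "\<dots> = (\<lambda>k. min (k + 1) r) ` {0..<card (pverts H)}"
    using f by (simp add: bij_betw_def)
  also have "\<dots> = {1..r}"
  proof (intro equalityI subsetI)
    fix k assume "k \<in> {1..r}"
    then show "k \<in> (\<lambda>k. min (k + 1) r) ` {0..<card (pverts H)}"
      using assms by (intro image_eqI[of _ _ "k - 1"]) auto
  qed (use assms in auto)
  finally show ?thesis
    unfolding exact_coloring_def by blast
qed

lemma no_rainbow_if_two_colors:
  assumes "exact_coloring H r c" "r \<le> 2"
  shows "\<not> has_rainbow_three_AP H c"
proof
  assume "has_rainbow_three_AP H c"
  then obtain S where S: "three_AP H S" "inj_on c S"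
    unfolding has_rainbow_three_AP_def rainbow_def by blast
  then have "card S = 3" "S \<subseteq> pverts H"
    unfolding three_AP_def by auto
  then have "card (c ` S) = 3" "c ` S \<subseteq> {1..r}"
    using S(2) assms(1) card_image unfolding exact_coloring_def by fastforce+
  then show False
    using card_mono[of "{1..r}" "c ` S"] assms(2) by simp
qed

lemma aw3_eqI:
  assumes "finite (pverts H)" "1 \<le> r" "r \<le> card (pverts H)"
    and rainbow: "\<And>c. exact_coloring H r c \<Longrightarrow> has_rainbow_three_AP H c"
    and no_rainbow: "\<And>s. 1 \<le> s \<Longrightarrow> s < r \<Longrightarrow> \<exists>c. exact_coloring H s c \<and> \<not> has_rainbow_three_AP H c"
  shows "aw3 H = r"
proof -
  have "\<exists>r c. exact_coloring H r c \<and> has_rainbow_three_AP H c"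
    using ex_exact_coloring[OF assms(1-3)] rainbow by blast
  moreover have "(LEAST r. r > 0 \<and> (\<forall>c. exact_coloring H r c \<longrightarrow> has_rainbow_three_AP H c)) = r"
  proof (rule Least_equality)
    fix s assume "s > 0 \<and> (\<forall>c. exact_coloring H s c \<longrightarrow> has_rainbow_three_AP H c)"
    then show "r \<le> s"
      using no_rainbow[of s] by (cases "s < r") auto
  qed (use assms in auto)
  ultimately show ?thesis
    unfolding aw3_def by simp
qed

lemma cycle_graph_arc_offset:
  assumes "(i, j) \<in> parcs (cycle_graph k)"
  obtains s where "\<bar>s\<bar> = 1" "int j mod int k = (int i + s) mod int k"
proof -
  consider "j = (i + 1) mod k" | "i = (j + 1) mod k" "j < k"
    using assms by (auto simp: cycle_graph_def)
  then show thesis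
  proof cases
    case 1
    then show thesis
      by (intro that[of 1]) (simp_all add: zmod_int add.commute)
  next
    case 2
    have "(int i + - 1) mod int k = (int j + 1 + - 1) mod int k"
      unfolding 2(1) zmod_int of_nat_add of_nat_1 by (rule mod_add_left_eq)
    then show thesis
      by (intro that[of "- 1"]) simp_all
  qed
qed

lemma cycle_graph_arcI:
  assumes "0 < k" "i < k" "\<bar>s\<bar> = 1"
  shows "(i, nat ((int i + s) mod int k)) \<in> parcs (cycle_graph k)"
proof -
  define j where "j = nat ((int i + s) mod int k)"
  have j: "int j = (int i + s) mod int k" "j < k"
    using assms(1) by (simp_all add: j_def nat_less_iff)
  consider "s = 1" | "s = - 1"
    using assms(3) by linarith
  then have "j = (i + 1) mod k \<or> i = (j + 1) mod k"
  proof cases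
    case 1
    then have "int j = int ((i + 1) mod k)"
      using j by (simp add: zmod_int add.commute)
    then show ?thesis
      by linarith
  next
    case 2
    have "int ((j + 1) mod k) = ((int i + s) mod int k + 1) mod int k"
      by (simp add: zmod_int j add.commute)
    also have "\<dots> = (int i + s + 1) mod int k"
      by (rule mod_add_left_eq)
    also have "\<dots> = int i"
      using 2 assms(2) by simp
    finally show ?thesis
      by linarith
  qed
  then show ?thesis
    using assms j(2) by (simp add: cycle_graph_def flip: j_def)
qed

section \<open>Distance and diameter of the torus\<close>

locale torus =
  fixes m n :: nat
  assumes m: "3 \<le> m" and n: "3 \<le> n"
begin

abbreviation T :: "(nat \<times> nat) pair_pre_digraph" where
  "T \<equiv> cycle_graph m \<box> cycle_graph n"

abbreviation dist :: "int \<Rightarrow> int \<Rightarrow> int \<Rightarrow> int \<Rightarrow> int" where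
  "dist \<equiv> torus_dist (int m) (int n)"

lemma pverts_T: "pverts T = {..<m} \<times> {..<n}"
  by (simp add: cartesian_product_def cycle_graph_def)

lemma pair_graph_T: "pair_graph T"
  using m n by (intro pair_graph_cartesian_product pair_graph_cycle_graph)

lemma gdist_T:
  assumes "x < m" "y < n" "x' < m" "y' < n"
  shows "gdist T (x, y) (x', y') = ereal (real_of_int (dist x y x' y'))"
proof -
  define d where "d = (\<lambda>(x, y). nat (dist (int x) (int y) (int x') (int y')))"
  have nonneg: "0 \<le> cyc_dist m z" "0 \<le> cyc_dist n z" for z
    using cyc_dist_nonneg m n by simp_all
  have d: "int (d (i, j)) = cyc_dist m (int i - int x') + cyc_dist n (int j - int y')" for i j
    using nonneg by (simp add: d_def torus_dist_def)
  have "gdist T (x, y) (x', y') = ereal (real (d (x, y)))"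
  proof (rule gdist_eqI[OF pair_graph_T])
    show "(x, y) \<in> pverts T" "(x', y') \<in> pverts T"
      using assms by (simp_all add: pverts_T)
    show "d (x', y') = 0"
      by (simp add: d_def torus_dist_def cyc_dist_def)
  next
    fix u v :: "nat \<times> nat" assume uv: "(u, v) \<in> parcs T"
    obtain i j i' j' where u: "u = (i, j)" "v = (i', j')"
      by (cases u; cases v)
    have step: "cyc_dist k (int a - z) \<le> cyc_dist k (int b - z) + 1"
      if ab: "(a, b) \<in> parcs (cycle_graph k)" and k: "3 \<le> k" for a b k z
    proof -
      obtain s where s: "\<bar>s\<bar> = 1" "int b mod int k = (int a + s) mod int k"
        using cycle_graph_arc_offset[OF ab] .
      have "(int b - z) mod int k = (int a - z + s) mod int k"
        using mod_diff_cong[OF s(2) refl, of z] by (simp add: algebra_simps)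
      from cyc_dist_cong[OF this] show ?thesis
        using cyc_dist_step_le[of k s "int a - z"] s(1) k by simp
    qed
    have "i = i' \<and> (j, j') \<in> parcs (cycle_graph n) \<or> j = j' \<and> (i, i') \<in> parcs (cycle_graph m)"
      using uv by (auto simp: u cartesian_product_def)
    then have "int (d u) \<le> int (d v) + 1"
      using step[of i i' m "int x'"] step[of j j' n "int y'"] m n by (auto simp: d u)
    then show "d u \<le> d v + 1"
      by simp
  next
    fix u assume u: "u \<in> pverts T" "u \<noteq> (x', y')"
    obtain i j where ij: "u = (i, j)" "i < m" "j < n"
      using u by (auto simp: pverts_T)
    have descent: "\<exists>b. (a, b) \<in> parcs (cycle_graph k) \<and> cyc_dist k (int b - int z) = cyc_dist k (int a - int z) - 1"
      if az: "a < k" "z < k" "a \<noteq> z" for a k z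
    proof -
      have "cyc_dist k (int a - int z) \<noteq> 0"
        using az by (auto simp: cyc_dist_eq)
      then obtain s where s: "\<bar>s\<bar> = 1" "cyc_dist k (int a - int z + s) = cyc_dist k (int a - int z) - 1"
        using ex_cyc_dist_descent[of k "int a - int z"] az by auto
      define b where "b = nat ((int a + s) mod int k)"
      have "int b = (int a + s) mod int k"
        using az by (simp add: b_def)
      then have "(int b - int z) mod int k = (int a - int z + s) mod int k"
        by (simp add: mod_diff_left_eq algebra_simps)
      from cyc_dist_cong[OF this] have "cyc_dist k (int b - int z) = cyc_dist k (int a - int z) - 1"
        using s(2) by simp
      moreover have "(a, b) \<in> parcs (cycle_graph k)"
        unfolding b_def using az s(1) by (intro cycle_graph_arcI) auto
      ultimately show ?thesis
        by blast
    qed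
    have "\<exists>v. (u, v) \<in> parcs T \<and> int (d u) = int (d v) + 1"
    proof (cases "i = x'")
      case True
      then obtain b where "(j, b) \<in> parcs (cycle_graph n)"
        "cyc_dist n (int b - int y') = cyc_dist n (int j - int y') - 1"
        using descent[of j n y'] ij u assms by auto
      then show ?thesis
        using ij by (intro exI[of _ "(i, b)"]) (simp add: d cartesian_product_def cycle_graph_def)
    next
      case False
      then obtain b where "(i, b) \<in> parcs (cycle_graph m)"
        "cyc_dist m (int b - int x') = cyc_dist m (int i - int x') - 1"
        using descent[of i m x'] ij u assms by auto
      then show ?thesis
        using ij by (intro exI[of _ "(b, j)"]) (simp add: d cartesian_product_def cycle_graph_def)
    qed
    then show "\<exists>v. (u, v) \<in> parcs T \<and> d u = Suc (d v)"
      by (metis Suc_eq_plus1 of_nat_1 of_nat_add of_nat_eq_iff)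
  qed
  also have "\<dots> = ereal (real_of_int (dist x y x' y'))"
    using nonneg by (simp add: d_def torus_dist_def)
  finally show ?thesis .
qed

lemma dist_le: "dist x y x' y' \<le> int (m div 2 + n div 2)"
proof -
  have "cyc_dist k z \<le> int (k div 2)" if "3 \<le> k" for k z
    using cyc_dist_le[of k z] that by (simp add: zdiv_int)
  then show ?thesis
    using m n by (simp add: torus_dist_def add_mono)
qed

lemma diam_T: "diam T = ereal (real (m div 2 + n div 2))"
  unfolding diam_def
proof (rule antisym)
  show "(SUP u\<in>pverts T. SUP v\<in>pverts T. gdist T u v) \<le> ereal (real (m div 2 + n div 2))"
  proof (intro SUP_least)
    fix u v assume "u \<in> pverts T" "v \<in> pverts T"
    then obtain x y x' y' where *: "u = (x, y)" "v = (x', y')" "x < m" "y < n" "x' < m" "y' < n"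
      by (auto simp: pverts_T)
    have "real_of_int (dist x y x' y') \<le> real_of_int (int (m div 2 + n div 2))"
      using dist_le by (subst of_int_le_iff)
    then show "gdist T u v \<le> ereal (real (m div 2 + n div 2))"
      using * by (simp add: gdist_T)
  qed
  have "dist 0 0 (int (m div 2)) (int (n div 2)) = int (m div 2 + n div 2)"
    by (simp add: torus_dist_def cyc_dist_abs)
  then have "gdist T (0, 0) (m div 2, n div 2) = ereal (real (m div 2 + n div 2))"
    using gdist_T[of 0 0 "m div 2" "n div 2"] m n by simp
  then show "ereal (real (m div 2 + n div 2)) \<le> (SUP u\<in>pverts T. SUP v\<in>pverts T. gdist T u v)"
    using m n by (intro SUP_upper2[of "(0, 0)"] SUP_upper2[of "(m div 2, n div 2)"]) (simp_all add: pverts_T)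
qed

section \<open>Torus colorings as periodic colorings of the plane\<close>

definition unroll :: "(nat \<times> nat \<Rightarrow> 'c) \<Rightarrow> int \<Rightarrow> int \<Rightarrow> 'c" where
  "unroll c x y = c (nat (x mod int m), nat (y mod int n))"

lemma unroll_vertex: "x < m \<Longrightarrow> y < n \<Longrightarrow> unroll c (int x) (int y) = c (x, y)"
  by (simp add: unroll_def)

lemma unroll_cong:
  assumes "int m dvd x - x'" "int n dvd y - y'"
  shows "unroll c x y = unroll c x' y'"
proof -
  have "x mod int m = x' mod int m" "y mod int n = y' mod int n"
    using assms by (simp_all add: mod_eq_dvd_iff)
  then show ?thesis
    by (simp add: unroll_def)
qed

text \<open>The map \<open>h\<close> merges colors. A triple that is rainbow after merging was
  rainbow before, so merging creates no rainbow progression.\<close>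

lemma torus_coloring_unroll:
  assumes "\<not> has_rainbow_three_AP T c" and h: "h ` c ` pverts T = {R, B, G}" and "distinct [R, B, G]"
  shows "torus_coloring (int m) (int n) (unroll (h \<circ> c)) R B G"
proof unfold_locales
  define v where "v x y = (nat (x mod int m), nat (y mod int n))" for x y
  have v: "v x y \<in> pverts T" for x y
    using m n by (simp add: v_def pverts_T nat_less_iff)
  fix x y
  show "unroll (h \<circ> c) x y = R \<or> unroll (h \<circ> c) x y = B \<or> unroll (h \<circ> c) x y = G"
    using imageI[OF imageI[OF v], of h c x y] unfolding h by (auto simp: unroll_def v_def)
  fix x1 y1 x2 y2 x3 y3
  have gdist: "gdist T (v x y) (v x' y') = ereal (real_of_int (dist x y x' y'))" for x y x' y'
  proof -
    have "dist (x mod m) (y mod n) (x' mod m) (y' mod n) = dist x y x' y'"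
      unfolding torus_dist_def by (intro arg_cong2[of _ _ _ _ "(+)"] cyc_dist_cong mod_diff_eq)
    then show ?thesis
      using gdist_T[of "fst (v x y)" "snd (v x y)" "fst (v x' y')" "snd (v x' y')"] m n
      by (simp add: v_def nat_less_iff)
  qed
  assume eq: "dist x1 y1 x2 y2 = dist x2 y2 x3 y3"
  show "unroll (h \<circ> c) x1 y1 = unroll (h \<circ> c) x2 y2 \<or> unroll (h \<circ> c) x2 y2 = unroll (h \<circ> c) x3 y3 \<or>
    unroll (h \<circ> c) x1 y1 = unroll (h \<circ> c) x3 y3"
  proof (rule ccontr)
    assume "\<not> ?thesis"
    then have ne: "h (c (v x1 y1)) \<noteq> h (c (v x2 y2))" "h (c (v x2 y2)) \<noteq> h (c (v x3 y3))"
      "h (c (v x1 y1)) \<noteq> h (c (v x3 y3))"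
      by (auto simp: unroll_def v_def)
    have "three_AP T {v x1 y1, v x2 y2, v x3 y3}"
      unfolding three_AP_def
    proof (intro exI conjI)
      show "gdist T (v x1 y1) (v x2 y2) = gdist T (v x2 y2) (v x3 y3)"
        by (simp add: gdist eq)
    qed (use ne v in auto)
    moreover have "rainbow c {v x1 y1, v x2 y2, v x3 y3}"
      unfolding rainbow_def using ne by (auto simp: inj_on_def)
    ultimately show False
      using assms(1) unfolding has_rainbow_three_AP_def by blast
  qed
qed (use assms(3) m n in \<open>auto intro: unroll_cong\<close>)

lemma ex_unroll: "k \<in> f ` pverts T \<Longrightarrow> \<exists>x y. unroll f x y = k"
  by (auto simp: pverts_T) (metis unroll_vertex)

lemma antipodal_color_classes:
  assumes "\<not> has_rainbow_three_AP T c" "h ` c ` pverts T = {R, B, G}" "distinct [R, B, G]"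
  obtains P Q where "even m" "even n" "odd (m div 2 + n div 2)"
    "P \<in> {R, B, G}" "Q \<in> {R, B, G}" "P \<noteq> Q"
    "\<And>x y x' y'. unroll (h \<circ> c) x y = P \<Longrightarrow> unroll (h \<circ> c) x' y' = Q \<Longrightarrow>
      dist x y x' y' = int (m div 2 + n div 2)"
proof -
  interpret t: torus_coloring "int m" "int n" "unroll (h \<circ> c)" R B G
    using assms by (rule torus_coloring_unroll)
  have color: "\<exists>x y. unroll (h \<circ> c) x y = k" if "k \<in> {R, B, G}" for k
    using that ex_unroll[of k "h \<circ> c"] unfolding image_comp[symmetric] assms(2) by blast
  have half: "int m div 2 + int n div 2 = int (m div 2 + n div 2)"
    by (simp add: zdiv_int)
  have "\<exists>x y. unroll (h \<circ> c) x y = R" "\<exists>x y. unroll (h \<circ> c) x y = B" "\<exists>x y. unroll (h \<circ> c) x y = G"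
    by (rule color; simp)+
  from t.antipodal_pair[OF this, unfolded half even_of_nat] show thesis
    using that by blast
qed

lemma parity_if_rainbow_free:
  assumes "exact_coloring T 3 c" "\<not> has_rainbow_three_AP T c"
  shows "even m \<and> even n \<and> odd (m div 2 + n div 2)"
proof -
  have "id ` c ` pverts T = {1, 2, 3}"
    using assms(1) unfolding exact_coloring_def by auto
  from antipodal_color_classes[OF assms(2) this] show ?thesis
    by auto
qed

text \<open>The distance sum reaches its maximum only if both offsets do, and on an even cycle just
  one vertex is at maximal offset.\<close>

lemma antipode_unique:
  assumes "even m" "even n" "dist x y x' y' = int (m div 2 + n div 2)"
  shows "unroll c x' y' = unroll c (x - int (m div 2)) (y - int (n div 2))"
proof -
  have half: "int k dvd z' - (z - int (k div 2))"
    if k: "even k" "3 \<le> k" and z: "int (k div 2) \<le> cyc_dist k (z - z')" for k z z'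
  proof -
    obtain l where l: "k = 2 * l"
      using k(1) ..
    have "l \<le> (z - z') mod (2 * int l)" "l \<le> 2 * int l - (z - z') mod (2 * int l)"
      using z k(2) by (simp_all add: l cyc_dist_mod)
    then have "(z - z') mod int k = int l mod int k"
      using k(2) by (simp add: l)
    then have "int k dvd z - z' - int l"
      by (simp add: mod_eq_dvd_iff)
    then have "int k dvd - (z - z' - int l)"
      by (subst dvd_minus_iff)
    then show ?thesis
      by (simp add: l algebra_simps)
  qed
  have le: "cyc_dist k z \<le> int (k div 2)" if "3 \<le> k" for k z
    using cyc_dist_le[of k z] that by (simp add: zdiv_int)
  have "int (m div 2) \<le> cyc_dist m (x - x')" "int (n div 2) \<le> cyc_dist n (y - y')"
    using assms(3) le[OF m, of "x - x'"] le[OF n, of "y - y'"] unfolding torus_dist_def by linarith+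
  then show ?thesis
    using assms(1,2) m n by (intro unroll_cong half)
qed

lemma rainbow_if_four_colors:
  assumes "exact_coloring T 4 c"
  shows "has_rainbow_three_AP T c"
proof (rule ccontr)
  assume no_rainbow: "\<not> ?thesis"
  have image: "c ` pverts T = {1, 2, 3, 4}"
    using assms unfolding exact_coloring_def by auto
  have ex: "\<exists>x y. unroll c x y = l" if "l \<in> {1, 2, 3, 4}" for l
    using that unfolding image[symmetric] by (rule ex_unroll)
  have antipodal: "even m \<and> even n \<and> dist x y x' y' = int (m div 2 + n div 2)"
    if ijk: "{i, j, k} = {1, 2, 3}" "i \<noteq> j" "j \<noteq> k" "i \<noteq> k" and xy: "unroll c x y = i" "unroll c x' y' = j"
    for i j k x y x' y'
  proof -
    \<comment> \<open>Color 4 is merged into \<open>k\<close>, the color outside the pair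
      \<open>i\<close>, \<open>j\<close> under consideration.\<close>
    define h where "h l = (if l = 4 then k else l)" for l
    have ne4: "i \<noteq> 4" "j \<noteq> 4" "k \<noteq> 4"
      using ijk(1) by force+
    have image_ijk: "c ` pverts T = {i, j, k, 4}"
      unfolding image using ijk(1) by (metis insert_commute)
    have "h ` c ` pverts T = {i, j, k}"
      unfolding image_ijk using ne4 by (auto simp: h_def)
    moreover have "distinct [i, j, k]"
      using ijk by simp
    ultimately obtain P Q where even: "even m" "even n"
      and PQ: "P \<in> {i, j, k}" "Q \<in> {i, j, k}" "P \<noteq> Q"
      and dist: "\<And>x y x' y'. unroll (h \<circ> c) x y = P \<Longrightarrow> unroll (h \<circ> c) x' y' = Q \<Longrightarrow>
        dist x y x' y' = int (m div 2 + n div 2)"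
      by (rule antipodal_color_classes[OF no_rainbow]) (rule that)
    have unroll_h: "unroll (h \<circ> c) x y = h (unroll c x y)" for x y
      by (simp add: unroll_def)
    \<comment> \<open>The antipodal pair cannot involve the merged class: a vertex of the other
      class would have antipodes of colors \<open>k\<close> and 4.\<close>
    have unmerged: False
      if O: "O' \<in> {i, j}" and d: "\<And>x y x' y'. h (unroll c x y) = O' \<Longrightarrow> h (unroll c x' y') = k \<Longrightarrow>
        dist x y x' y' = int (m div 2 + n div 2)" for O'
    proof -
      obtain x1 y1 x2 y2 x3 y3 where xy: "unroll c x1 y1 = O'" "unroll c x2 y2 = k" "unroll c x3 y3 = 4"
        using ex image image_ijk O by (metis insertCI insertE singletonD)
      have h: "h (unroll c x1 y1) = O'" "h (unroll c x2 y2) = k" "h (unroll c x3 y3) = k"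
        using O ne4 by (auto simp: xy h_def)
      from d[OF h(1,2)] d[OF h(1,3)] show False
        using antipode_unique[OF even, of x1 y1 _ _ c] xy ne4 by metis
    qed
    have "P \<noteq> k"
      using unmerged[of Q] dist PQ torus_dist_commute unroll_h by (metis insertE singletonD insertCI)
    moreover have "Q \<noteq> k"
      using unmerged[of P] dist PQ unroll_h by (metis insertE singletonD insertCI)
    ultimately consider "P = i" "Q = j" | "P = j" "Q = i"
      using PQ by blast
    then have "dist x y x' y' = int (m div 2 + n div 2)"
    proof cases
      case 1
      then show ?thesis
        using xy ne4 by (intro dist) (simp_all add: unroll_h h_def)
    next
      case 2
      then show ?thesis
        unfolding torus_dist_commute[of _ _ x y]
        using xy ne4 by (intro dist) (simp_all add: unroll_h h_def)
    qed
    with even show ?thesis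
      by simp
  qed
  obtain x1 y1 x2 y2 x3 y3 where xy: "unroll c x1 y1 = 1" "unroll c x2 y2 = 2" "unroll c x3 y3 = 3"
    using ex by (metis insertCI)
  have "{1, 3, 2} = {1, 2, 3 :: nat}"
    by auto
  then have "even m" "even n" "dist x1 y1 x2 y2 = int (m div 2 + n div 2)"
    "dist x1 y1 x3 y3 = int (m div 2 + n div 2)"
    using antipodal[OF refl _ _ _ xy(1,2)] antipodal[OF _ _ _ _ xy(1,3)] by simp_all
  then have "unroll c x2 y2 = unroll c x3 y3"
    using antipode_unique[of x1 y1 _ _ c] by metis
  then show False
    by (simp add: xy)
qed

section \<open>The rainbow-free coloring and the value of \<open>aw3\<close>\<close>

lemma ex_rainbow_free_coloring:
  assumes "even m" "even n" "odd (m div 2 + n div 2)"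
  shows "\<exists>c. exact_coloring T 3 c \<and> \<not> has_rainbow_three_AP T c"
proof -
  define z :: "nat \<times> nat" where "z = (0, 0)"
  define a where "a = (m div 2, n div 2)"
  define c where "c v = (if v = z then 1 else if v = a then 2 else 3 :: nat)" for v
  define d where "d u v = dist (int (fst u)) (int (snd u)) (int (fst v)) (int (snd v))" for u v :: "nat \<times> nat"
  have za: "z \<in> pverts T" "a \<in> pverts T" "z \<noteq> a"
    using m n by (auto simp: z_def a_def pverts_T)
  have "(1, 0) \<in> pverts T" "(1, 0) \<noteq> z" "(1, 0) \<noteq> a"
    using m n by (auto simp: z_def a_def pverts_T)
  then have "exact_coloring T 3 c"
    using za unfolding exact_coloring_def c_def
    by (auto simp: image_iff numeral_3_eq_3 atLeastAtMostSuc_conv)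
  moreover have "\<not> has_rainbow_three_AP T c"
  proof
    have gdist: "gdist T u v = ereal (real_of_int (d u v))" if "u \<in> pverts T" "v \<in> pverts T" for u v
      using gdist_T[of "fst u" "snd u" "fst v" "snd v"] that by (auto simp: pverts_T d_def)
    have commute: "d u v = d v u" for u v
      unfolding d_def by (rule torus_dist_commute)
    have sum: "d z v + d v a = int (m div 2 + n div 2)" if "v \<in> pverts T" for v
    proof -
      obtain x y where v: "v = (x, y)" "x < m" "y < n"
        using \<open>v \<in> pverts T\<close> by (auto simp: pverts_T)
      have "d z v = cyc_dist m x + cyc_dist n y"
        by (simp add: d_def v z_def torus_dist_def cyc_dist_minus)
      moreover have "cyc_dist m x + cyc_dist m (int x - int m div 2) = int m div 2"
          "cyc_dist n y + cyc_dist n (int y - int n div 2) = int n div 2"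
        using v assms by (intro cyc_dist_antipode; simp)+
      ultimately show ?thesis
        by (simp add: d_def v a_def torus_dist_def zdiv_int)
    qed
    have eq: "u = v" if "d u v = 0" "u \<in> pverts T" "v \<in> pverts T" for u v
    proof -
      have k: "i = j" if "cyc_dist k (int i - int j) \<le> 0" "i < k" "j < k" for i j k
        using that by (auto simp: cyc_dist_eq min_def split: if_splits)
      have "cyc_dist m (int (fst u) - int (fst v)) \<le> 0" "cyc_dist n (int (snd u) - int (snd v)) \<le> 0"
        using that(1) cyc_dist_nonneg[of m "int (fst u) - int (fst v)"]
          cyc_dist_nonneg[of n "int (snd u) - int (snd v)"] m n
        by (simp_all add: d_def torus_dist_def)
      then show ?thesis
        using k that(2,3) by (auto simp: pverts_T intro!: prod_eqI)
    qed
    have zz: "d z z = 0"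
      by (simp add: d_def torus_dist_def cyc_dist_def)
    assume "has_rainbow_three_AP T c"
    then obtain v1 v2 v3 where v: "v1 \<in> pverts T" "v2 \<in> pverts T" "v3 \<in> pverts T"
      and ap: "d v1 v2 = d v2 v3" and colors: "c v1 \<noteq> c v2" "c v2 \<noteq> c v3" "c v1 \<noteq> c v3"
      unfolding has_rainbow_three_AP_def three_AP_def rainbow_def by (auto simp: gdist)
    \<comment> \<open>A rainbow triple consists of \<open>z\<close>, \<open>a\<close> and one more
      vertex \<open>w\<close>. The three facts rule out \<open>w\<close>, \<open>z\<close> and
      \<open>a\<close> as middle term: the first by parity of the diameter, the others because a
      vertex has only one antipode.\<close>
    have not_mid: "d z w \<noteq> d w a" if "w \<in> pverts T" for w
      using sum[OF that] assms(3) by presburger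
    have not_z: "d z a \<noteq> d z w" if "w \<in> pverts T" "w \<noteq> a" for w
      using sum[OF that(1)] sum[OF za(1)] zz eq[of w a] that za by auto
    have not_a: "d z a \<noteq> d w a" if "w \<in> pverts T" "w \<noteq> z" for w
      using sum[OF that(1)] sum[OF za(1)] zz eq[of z w] that za by auto
    from colors consider "v1 = z" "v3 = a" | "v1 = a" "v3 = z" | "v2 = z" "v3 = a" | "v2 = z" "v1 = a"
      | "v1 = z" "v2 = a" | "v2 = a" "v3 = z"
      by (auto simp: c_def split: if_splits)
    then show False
      by cases (metis ap not_mid not_z not_a v commute colors)+
  qed
  ultimately show ?thesis
    by blast
qed

lemma aw3_T: "aw3 T = (if even m \<and> even n \<and> odd (m div 2 + n div 2) then 4 else 3)"
proof -
  have fin: "finite (pverts T)"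
    by (simp add: pverts_T)
  have "9 \<le> card (pverts T)"
    using mult_le_mono[OF m n] by (simp add: pverts_T card_cartesian_product)
  then have card: "4 \<le> card (pverts T)"
    by simp
  have small: "\<exists>c. exact_coloring T s c \<and> \<not> has_rainbow_three_AP T c" if "1 \<le> s" "s \<le> 2" for s
    using ex_exact_coloring[OF fin that(1)] no_rainbow_if_two_colors[OF _ that(2)] card that(2) by fastforce
  show ?thesis
  proof (cases "even m \<and> even n \<and> odd (m div 2 + n div 2)")
    case True
    have "aw3 T = 4"
    proof (rule aw3_eqI[OF fin _ card rainbow_if_four_colors])
      fix s :: nat assume "1 \<le> s" "s < 4"
      then show "\<exists>c. exact_coloring T s c \<and> \<not> has_rainbow_three_AP T c"
        using small[of s] ex_rainbow_free_coloring True by (cases "s = 3") auto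
    qed simp
    then show ?thesis
      using True by simp
  next
    case False
    have "aw3 T = 3"
      by (rule aw3_eqI[OF fin]) (use card small parity_if_rainbow_free False in auto)
    then show ?thesis
      using False by simp
  qed
qed

end

theorem theorem7:
  fixes m n :: nat
  assumes "m \<ge> 3" and "n \<ge> 3"
  shows "aw3 (cycle_graph m \<box> cycle_graph n) =
    (if even m \<and> even n \<and>
        (\<exists>d::nat. odd d \<and> diam (cycle_graph m \<box> cycle_graph n) = ereal (real d))
     then 4 else 3)"
proof -
  interpret torus m n
    using assms by unfold_locales
  have "(\<exists>d::nat. odd d \<and> diam (cycle_graph m \<box> cycle_graph n) = ereal (real d)) \<longleftrightarrow>
      odd (m div 2 + n div 2)"
    unfolding diam_T by (metis ereal.inject of_nat_eq_iff)
  then show ?thesis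
    using aw3_T by simp
qed

end
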